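(* Assume that $T$ and the random operators $\{\widehat T_n\}_{n\ge1}$ satisfy: (1) $P(\lim_{n\to\infty}\|\widehat T_n v-Tv\|\ge\epsilon)=0$ for all $\epsilon>0$ and all $v\in\mathbb{R}^{|\mathbb{S}|}$ (i.e. $\widehat T_n(\omega)v\to Tv$ for $P$-almost all $\omega$), and $T$ has a fixed point $v^*$, $Tv^*=v^*$; (2) there is $\kappa^*<\infty$ with $\|v^*\|\le\kappa^*$ such that $\|\hat v_n^k\|\le\kappa^*$ almost surely for all $k\ge0$, $n\ge1$ (for seeds $\hat v_n^0$ with $\|\hat v_n^0\|\le\kappa^*$); (3) $\|Tv-v^*\|\le\alpha\|v-v^*\|$ for all $v\in\mathbb{R}^{|\mathbb{S}|}$; (4) for every $\epsilon>0$ there is a sequence $\{p_n(\epsilon)\}_{n\ge1}$ with $P(\|Tv-\widehat T_nv\|<\epsilon)>p_n(\epsilon)$ for all $v$ with $\|v\|\le\kappa^*$, and $p_n(\epsilon)\uparrow1$ as $n\to\infty$. Then for any $\epsilon>0$, $$\lim_{n\to\infty}\limsup_{k\to\infty}\mathcal P\left(\|\hat v_n^k-v^*\|>\epsilon\right)=0,$$ i.e. $v^*$ is a weak probabilistic fixed point of $\{\widehat T_n\}_{n\ge1}$.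
   Context: $\mathbb{S}$ is a finite set, $\|\cdot\|$ the sup norm on $\mathbb{R}^{|\mathbb{S}|}$, $\alpha\in(0,1)$ a constant, $T:\mathbb{R}^{|\mathbb{S}|}\to\mathbb{R}^{|\mathbb{S}|}$ a deterministic operator. $\Omega=[0,1]^\infty$ with its product Borel $\sigma$-algebra $\mathcal F$ and the law $P$ of an i.i.d. sequence of uniform $[0,1]$ variables. For each $n\ge1$, $\widehat T_n$ is a random operator: for each $\omega\in\Omega$, $\widehat T_n(\omega)$ is a map $\mathbb{R}^{|\mathbb{S}|}\to\mathbb{R}^{|\mathbb{S}|}$ (jointly measurable in $(\omega,v)$). On the infinite product $(\Omega^\infty,\mathcal F^\infty,\mathcal P)$ with elements $\boldsymbol\omega=(\omega_j)_{j\ge0}$, whose coordinates are i.i.d. with law $P$, define $\widehat T_n^k(\boldsymbol\omega)v=\widehat T_n(\omega_{k-1})\cdots\widehat T_n(\omega_0)v$ and, for a seed $\hat v_n^0\in\mathbb{R}^{|\mathbb{S}|}$, $\hat v_n^k=\widehat T_n^k\hat v_n^0$. Convention: in these iterations (only), a vector $v$ with $\|v\|>\kappa^*$ is mapped at the next step to its projection $\kappa^*v/\|v\|$ onto the closed ball of radius $\kappa^*$. A vector $\hat v\in\mathbb{R}^{|\mathbb{S}|}$ is a weak probabilistic fixed point of $\{\widehat T_n\}_{n\ge1}$ if $\lim_{n\to\infty}\limsup_{k\to\infty}\mathcal P(\|\widehat T_n^kv-\hat v\|>\epsilon)=0$ for all $\epsilon>0$ and all $v\in\mathbb{R}^{|\mathbb{S}|}$.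 *)

theory Defs
  imports "HOL-Probability.Probability"
begin

text \<open>
  Vectors indexed by the finite set of states are elements of \<^typ>\<open>real ^ 's\<close>, and the sup norm is
  the library's \<^const>\<open>infnorm\<close> (not \<^const>\<open>norm\<close>, which is the Euclidean norm there).
\<close>

text \<open>The space \<open>[0,1]\<^sup>\<infinity>\<close> with the law of an i.i.d. sequence of uniform \<open>[0,1]\<close> variables.\<close>

definition Omega :: "(nat \<Rightarrow> real) measure" where
  "Omega = PiM UNIV (\<lambda>_. restrict_space lborel {0..1})"

definition Omega_inf :: "(nat \<Rightarrow> nat \<Rightarrow> real) measure" where
  "Omega_inf = PiM UNIV (\<lambda>_. Omega)"

lemma prob_space_Omega: "prob_space Omega"
  unfolding Omega_def
  by (intro prob_space_PiM prob_spaceI) (simp add: space_restrict_space emeasure_restrict_space)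

lemma prob_space_Omega_inf: "prob_space Omega_inf"
  unfolding Omega_inf_def by (intro prob_space_PiM prob_space_Omega)

lemma space_Omega: "space Omega = {\<omega>. \<forall>i. \<omega> i \<in> {0..1}}"
  by (auto simp: Omega_def space_PiM space_restrict_space PiE_def)

text \<open>
  One step of the iteration: a vector outside the closed sup-norm ball of radius \<open>\<kappa>\<close> is sent to
  its radial projection onto that ball \<^emph>\<open>instead of\<close> being mapped by the operator.
\<close>

definition proj_step :: "real \<Rightarrow> (real ^ 's \<Rightarrow> real ^ 's) \<Rightarrow> real ^ 's \<Rightarrow> real ^ 's" where
  "proj_step \<kappa> f v = (if infnorm v > \<kappa> then (\<kappa> / infnorm v) *\<^sub>R v else f v)"

primrec iterate ::
  "real \<Rightarrow> ('w \<Rightarrow> real ^ 's \<Rightarrow> real ^ 's) \<Rightarrow> nat \<Rightarrow> (nat \<Rightarrow> 'w) \<Rightarrow> real ^ 's \<Rightarrow> real ^ 's"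
where
  "iterate \<kappa> F 0 w v = v"
| "iterate \<kappa> F (Suc k) w v = proj_step \<kappa> (F (w k)) (iterate \<kappa> F k w v)"

text \<open>
  The radius \<open>\<kappa>\<close> is a parameter because the projection convention is part of the iterates.
  The value of the family at index 0 is irrelevant here.
  Probabilities are embedded into \<^typ>\<open>ereal\<close> only because \<^const>\<open>limsup\<close> needs a complete lattice.
\<close>

definition weak_prob_fixed_point ::
  "real \<Rightarrow> (nat \<Rightarrow> (nat \<Rightarrow> real) \<Rightarrow> real ^ 's \<Rightarrow> real ^ 's) \<Rightarrow> real ^ 's \<Rightarrow> bool"
where
  "weak_prob_fixed_point \<kappa> That vhat \<longleftrightarrow>
     (\<forall>\<epsilon>>0. \<forall>v.
        (\<lambda>n. limsup (\<lambda>k. ereal (\<P>(w in Omega_inf. infnorm (iterate \<kappa> (That n) k w v - vhat) > \<epsilon>))))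
        \<longlonglongrightarrow> 0)"

end

theory Submission
  imports Defs
begin

text \<open>
  Let \<open>e v\<close> be the sup-norm distance from \<open>v\<close> to the fixed point \<open>vstar\<close>. If \<open>v\<close> lies in the ball of
  radius \<open>\<kappa>\<close>, one random step gives \<open>e (That n \<omega> v) \<le> \<alpha> * e v + \<delta>\<close> unless the operator misses \<open>T v\<close>
  by \<open>\<delta>\<close> or more, which has probability at most \<open>1 - p n\<close>; and even then \<open>e (That n \<omega> v) \<le> 2 * \<kappa>\<close>,
  because the step almost surely stays in the ball. In expectation this is the drift inequality
  \<open>E e (That n \<omega> v) \<le> \<alpha> * e v + C\<close> with \<open>C = \<delta> + 2 * \<kappa> * (1 - p n)\<close>, proved in
  \<open>expected_error_step\<close>.

  As the steps are independent, the inequality can be iterated, and the expected error after \<open>k\<close>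
  steps is at most \<open>\<alpha> ^ k * e v + C / (1 - \<alpha>)\<close> (\<open>expected_iterate_bound\<close>). The iteration runs
  backwards, splitting off the first step and not the last one: the law of the noise sequence is
  unchanged when one fresh sample is put in front of it, so Fubini's theorem alone yields
  the recursion. A seed outside the ball is projected into it by the first, deterministic step.
  Markov's inequality then bounds the \<open>limsup\<close> over \<open>k\<close> of the deviation
  probability by \<open>C / ((1 - \<alpha>) * \<epsilon>)\<close>. Here \<open>n \<rightarrow> \<infinity>\<close> removes the second
  summand of \<open>C\<close>, and \<open>\<delta>\<close> is arbitrary.
\<close>

section \<open>The projected iteration\<close>

lemma borel_measurable_infnorm [measurable]:
  "(infnorm :: real ^ 's \<Rightarrow> real) \<in> borel_measurable borel"
  by (intro borel_measurable_continuous_onI continuous_intros)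

lemma infnorm_diff_le:
  fixes u v :: "real ^ 's"
  assumes "infnorm u \<le> a" "infnorm v \<le> b"
  shows "infnorm (u - v) \<le> a + b"
  using infnorm_triangle[of u "- v"] assms by (simp add: infnorm_neg)

lemma infnorm_proj_step_outside:
  fixes v :: "real ^ 's"
  assumes "0 \<le> \<kappa>" "infnorm v > \<kappa>"
  shows "infnorm (proj_step \<kappa> f v) = \<kappa>"
  using assms by (simp add: proj_step_def infnorm_mul)

lemma iterate_case_nat:
  "iterate \<kappa> F (Suc k) (case_nat s w) v = iterate \<kappa> F k w (proj_step \<kappa> (F s) v)"
  by (induction k) auto

section \<open>Expectations along the iteration\<close>

context sequence_space
begin

lemma measurable_proj_step:
  fixes F :: "'a \<Rightarrow> real ^ 's \<Rightarrow> real ^ 's"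
  assumes [measurable]: "(\<lambda>(s, v). F s v) \<in> borel_measurable (M \<Otimes>\<^sub>M borel)"
  shows "(\<lambda>(s, v). proj_step \<kappa> (F s) v) \<in> borel_measurable (M \<Otimes>\<^sub>M borel)"
  unfolding proj_step_def by measurable

lemma measurable_iterate:
  fixes F :: "'a \<Rightarrow> real ^ 's \<Rightarrow> real ^ 's"
  assumes F: "(\<lambda>(s, v). F s v) \<in> borel_measurable (M \<Otimes>\<^sub>M borel)"
  shows "(\<lambda>(w, v). iterate \<kappa> F k w v) \<in> borel_measurable (S \<Otimes>\<^sub>M borel)"
proof (induction k)
  case (Suc k)
  note [measurable] = Suc
  have "(\<lambda>(w, v). (w k, iterate \<kappa> F k w v)) \<in> S \<Otimes>\<^sub>M borel \<rightarrow>\<^sub>M M \<Otimes>\<^sub>M borel"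
    by measurable
  from measurable_compose[OF this measurable_proj_step[OF F, of \<kappa>]] show ?case
    by (simp add: split_beta')
qed simp

text \<open>
  The first noise sample decides where the rest of the iteration starts, and the rest of the
  noise sequence has the same law as the whole sequence and is independent of that sample.
\<close>

lemma nn_integral_iterate_Suc:
  fixes F :: "'a \<Rightarrow> real ^ 's \<Rightarrow> real ^ 's"
  assumes F: "(\<lambda>(s, v). F s v) \<in> borel_measurable (M \<Otimes>\<^sub>M borel)"
    and f [measurable]: "f \<in> borel_measurable borel"
  shows "(\<integral>\<^sup>+ w. f (iterate \<kappa> F (Suc k) w v) \<partial>S) =
         (\<integral>\<^sup>+ s. \<integral>\<^sup>+ w. f (iterate \<kappa> F k w (proj_step \<kappa> (F s) v)) \<partial>S \<partial>M)"
proof -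
  have [measurable]: "(\<lambda>w. iterate \<kappa> F k w v) \<in> borel_measurable S" for k v
    using measurable_compose[OF measurable_Pair2' measurable_iterate[OF F, of \<kappa> k]]
    by simp
  have cons [measurable]: "(\<lambda>(s, w). case_nat s w) \<in> M \<Otimes>\<^sub>M S \<rightarrow>\<^sub>M S"
    by measurable
  have "(\<integral>\<^sup>+ w. f (iterate \<kappa> F (Suc k) w v) \<partial>S) =
        (\<integral>\<^sup>+ w. f (iterate \<kappa> F (Suc k) w v) \<partial>distr (M \<Otimes>\<^sub>M S) S (\<lambda>(s, w). case_nat s w))"
    by (simp only: PiM_iter)
  also have "\<dots> = (\<integral>\<^sup>+ (s, w). f (iterate \<kappa> F (Suc k) (case_nat s w) v) \<partial>(M \<Otimes>\<^sub>M S))"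
    by (subst nn_integral_distr) (simp_all add: split_beta' del: iterate.simps)
  also have "\<dots> = (\<integral>\<^sup>+ s. \<integral>\<^sup>+ w. f (iterate \<kappa> F (Suc k) (case_nat s w) v) \<partial>S \<partial>M)"
    by (subst P.nn_integral_fst[symmetric]) (simp_all add: split_beta' del: iterate.simps)
  finally show ?thesis
    by (simp only: iterate_case_nat)
qed

text \<open>
  A drift inequality on an almost surely invariant ball, iterated as a geometric series. The bound
  on \<open>e\<close> for a deterministic start is applied to the random point reached
  after the first step, which is why it is proved for all starting points in the ball at once.
\<close>

lemma expected_iterate_bound:
  fixes F :: "'a \<Rightarrow> real ^ 's \<Rightarrow> real ^ 's" and e :: "real ^ 's \<Rightarrow> real"
  assumes F: "(\<lambda>(s, v). F s v) \<in> borel_measurable (M \<Otimes>\<^sub>M borel)"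
    and e [measurable]: "e \<in> borel_measurable borel" and e_nonneg: "\<And>v. 0 \<le> e v"
    and \<alpha>: "0 \<le> \<alpha>" "\<alpha> < 1" and C: "0 \<le> C"
    and inv: "\<And>v. infnorm v \<le> \<kappa> \<Longrightarrow> AE s in M. infnorm (F s v) \<le> \<kappa>"
    and drift: "\<And>v. infnorm v \<le> \<kappa> \<Longrightarrow> (\<integral>\<^sup>+ s. e (F s v) \<partial>M) \<le> ennreal (\<alpha> * e v + C)"
    and v: "infnorm v \<le> \<kappa>"
  shows "(\<integral>\<^sup>+ w. e (iterate \<kappa> F k w v) \<partial>S) \<le> ennreal (\<alpha> ^ k * e v + C / (1 - \<alpha>) * (1 - \<alpha> ^ k))"
  using v
proof (induction k arbitrary: v)
  case 0
  show ?case by (simp add: P.emeasure_space_1)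
next
  case (Suc k)
  have [measurable]: "(\<lambda>s. F s v) \<in> borel_measurable M"
    using measurable_compose[OF measurable_Pair2' F, of v] by simp
  define R where "R = C / (1 - \<alpha>) * (1 - \<alpha> ^ k)"
  have R: "0 \<le> R"
    using \<alpha> C by (simp add: R_def power_le_one)
  have "(\<integral>\<^sup>+ w. e (iterate \<kappa> F (Suc k) w v) \<partial>S) =
        (\<integral>\<^sup>+ s. \<integral>\<^sup>+ w. e (iterate \<kappa> F k w (F s v)) \<partial>S \<partial>M)"
    using Suc.prems by (subst nn_integral_iterate_Suc[OF F]) (simp_all add: proj_step_def)
  also have "\<dots> \<le> (\<integral>\<^sup>+ s. ennreal (\<alpha> ^ k * e (F s v) + R) \<partial>M)"
    unfolding R_def using inv[OF Suc.prems]
    by (intro nn_integral_mono_AE) (auto elim!: eventually_mono dest: Suc.IH)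
  also have "\<dots> = (\<integral>\<^sup>+ s. ennreal (\<alpha> ^ k) * ennreal (e (F s v)) + ennreal R \<partial>M)"
    using \<alpha> R e_nonneg by (simp add: ennreal_plus ennreal_mult)
  also have "\<dots> = ennreal (\<alpha> ^ k) * (\<integral>\<^sup>+ s. e (F s v) \<partial>M) + ennreal R"
    by (simp add: nn_integral_add nn_integral_cmult M.emeasure_space_1)
  also have "\<dots> \<le> ennreal (\<alpha> ^ k) * ennreal (\<alpha> * e v + C) + ennreal R"
    by (intro add_mono mult_left_mono drift Suc.prems) auto
  also have "\<dots> = ennreal (\<alpha> ^ k * (\<alpha> * e v + C) + R)"
    using \<alpha> C R e_nonneg by (simp add: ennreal_plus ennreal_mult)
  also have "\<alpha> ^ k * (\<alpha> * e v + C) + R = \<alpha> ^ Suc k * e v + C / (1 - \<alpha>) * (1 - \<alpha> ^ Suc k)"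
    using \<alpha> by (simp add: R_def field_simps)
  finally show ?case .
qed

text \<open>
  The tail bound holds for every seed: a seed outside the ball loses one step to its
  projection, hence the exponent \<open>k\<close> at time \<open>Suc k\<close>. In the ball the error is at most \<open>2 * \<kappa>\<close>, which
  makes the bound independent of the seed.
\<close>

lemma deviation_probability_bound:
  fixes F :: "'a \<Rightarrow> real ^ 's \<Rightarrow> real ^ 's"
  assumes F: "(\<lambda>(s, v). F s v) \<in> borel_measurable (M \<Otimes>\<^sub>M borel)"
    and \<alpha>: "0 \<le> \<alpha>" "\<alpha> < 1" and C: "0 \<le> C" and u: "infnorm u \<le> \<kappa>"
    and inv: "\<And>v. infnorm v \<le> \<kappa> \<Longrightarrow> AE s in M. infnorm (F s v) \<le> \<kappa>"
    and drift: "\<And>v. infnorm v \<le> \<kappa> \<Longrightarrow>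
      (\<integral>\<^sup>+ s. infnorm (F s v - u) \<partial>M) \<le> ennreal (\<alpha> * infnorm (v - u) + C)"
    and \<epsilon>: "0 < \<epsilon>"
  shows "\<P>(w in S. infnorm (iterate \<kappa> F (Suc k) w v - u) > \<epsilon>) \<le> (\<alpha> ^ k * (2 * \<kappa>) + C / (1 - \<alpha>)) / \<epsilon>"
proof -
  have [measurable]: "(\<lambda>w. iterate \<kappa> F k w v) \<in> borel_measurable S" for k v
    using measurable_compose[OF measurable_Pair2' measurable_iterate[OF F, of \<kappa> k]]
    by simp
  define B where "B = \<alpha> ^ k * (2 * \<kappa>) + C / (1 - \<alpha>)"
  have \<kappa>: "0 \<le> \<kappa>"
    using infnorm_pos_le[of u] u by linarith
  have B: "0 \<le> B"
    using \<alpha> C \<kappa> by (simp add: B_def)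
  have in_ball: "(\<integral>\<^sup>+ w. infnorm (iterate \<kappa> F j w x - u) \<partial>S) \<le> ennreal B"
    if "k \<le> j" "infnorm x \<le> \<kappa>" for j x
  proof -
    have "(\<integral>\<^sup>+ w. infnorm (iterate \<kappa> F j w x - u) \<partial>S) \<le>
          ennreal (\<alpha> ^ j * infnorm (x - u) + C / (1 - \<alpha>) * (1 - \<alpha> ^ j))"
      by (rule expected_iterate_bound[OF F, where e = "\<lambda>v. infnorm (v - u)"])
        (use \<alpha> C inv drift that in \<open>auto simp: infnorm_pos_le\<close>)
    also have "\<dots> \<le> ennreal B"
    proof (rule ennreal_leI)
      have "\<alpha> ^ j * infnorm (x - u) \<le> \<alpha> ^ k * (2 * \<kappa>)"
        using infnorm_diff_le[OF that(2) u] \<alpha> \<kappa> that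
        by (intro mult_mono power_decreasing) (auto simp: infnorm_pos_le)
      moreover have "C / (1 - \<alpha>) * (1 - \<alpha> ^ j) \<le> C / (1 - \<alpha>)"
        using \<alpha> C by (intro mult_left_le) auto
      ultimately show "\<alpha> ^ j * infnorm (x - u) + C / (1 - \<alpha>) * (1 - \<alpha> ^ j) \<le> B"
        by (simp add: B_def)
    qed
    finally show ?thesis .
  qed
  have expect: "(\<integral>\<^sup>+ w. infnorm (iterate \<kappa> F (Suc k) w v - u) \<partial>S) \<le> ennreal B"
  proof (cases "infnorm v \<le> \<kappa>")
    case True
    then show ?thesis by (intro in_ball) auto
  next
    case False
    define x where "x = (\<kappa> / infnorm v) *\<^sub>R v"
    have step: "proj_step \<kappa> f v = x" for f
      using False by (simp add: proj_step_def x_def)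
    have "infnorm x \<le> \<kappa>"
      using infnorm_proj_step_outside[OF \<kappa>, of v] False by (simp add: step)
    then have "(\<integral>\<^sup>+ w. infnorm (iterate \<kappa> F k w x - u) \<partial>S) \<le> ennreal B"
      by (intro in_ball) auto
    moreover have "(\<integral>\<^sup>+ w. infnorm (iterate \<kappa> F (Suc k) w v - u) \<partial>S) =
        (\<integral>\<^sup>+ w. infnorm (iterate \<kappa> F k w x - u) \<partial>S)"
      by (subst nn_integral_iterate_Suc[OF F, where f = "\<lambda>v. ennreal (infnorm (v - u))"])
        (simp_all add: step M.emeasure_space_1)
    ultimately show ?thesis by simp
  qed
  let ?X = "\<lambda>w. infnorm (iterate \<kappa> F (Suc k) w v - u)"
  have int: "integrable S ?X"
    using expect by (intro integrableI_nonneg) (auto simp: infnorm_pos_le top_unique less_top[symmetric] simp del: iterate.simps)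
  have "ennreal (\<integral>w. ?X w \<partial>S) \<le> ennreal B"
    using expect int by (subst nn_integral_eq_integral[symmetric]) (auto simp: infnorm_pos_le simp del: iterate.simps)
  then have mean: "(\<integral>w. ?X w \<partial>S) \<le> B"
    using B by simp
  have "\<P>(w in S. ?X w > \<epsilon>) \<le> \<P>(w in S. ?X w \<ge> \<epsilon>)"
    by (intro P.finite_measure_mono) (auto simp del: iterate.simps)
  also have "\<dots> \<le> (\<integral>w. ?X w \<partial>S) / \<epsilon>"
    by (rule integral_Markov_inequality_measure[OF int sets.empty_sets])
       (use \<epsilon> in \<open>auto simp: infnorm_pos_le simp del: iterate.simps\<close>)
  also have "\<dots> \<le> B / \<epsilon>"
    using mean \<epsilon> by (simp add: divide_right_mono)
  finally show ?thesis by (simp add: B_def)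
qed

text \<open>
  The iterates of a fixed seed involve a single noise coordinate after one step, so an almost
  sure bound on them is a bound on the random operator itself at that point.
\<close>

lemma AE_iterate_bound_imp_AE_step_bound:
  fixes F :: "'a \<Rightarrow> real ^ 's \<Rightarrow> real ^ 's"
  assumes F: "(\<lambda>(s, v). F s v) \<in> borel_measurable (M \<Otimes>\<^sub>M borel)"
    and v: "infnorm v \<le> \<kappa>"
    and bound: "AE w in S. infnorm (iterate \<kappa> F 1 w v) \<le> \<kappa>"
  shows "AE s in M. infnorm (F s v) \<le> \<kappa>"
proof -
  have [measurable]: "(\<lambda>s. F s v) \<in> borel_measurable M"
    using measurable_compose[OF measurable_Pair2' F, of v] by simp
  have "AE w in S. infnorm (F (w 0) v) \<le> \<kappa>"
    using bound v by (simp add: proj_step_def)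
  then have "AE s in distr S M (\<lambda>w. w 0). infnorm (F s v) \<le> \<kappa>"
    by (subst AE_distr_iff) auto
  then show ?thesis
    by (subst (asm) PiM_component) auto
qed

end

section \<open>The drift inequality\<close>

text \<open>
  Off the event that the random operator misses \<open>T v\<close> by \<open>\<delta>\<close> or more, the contraction of \<open>T\<close>
  applies up to \<open>\<delta>\<close>; on that event the diameter \<open>2 * \<kappa>\<close> of the ball bounds the error.
\<close>

lemma (in prob_space) expected_error_step:
  fixes T :: "real ^ 's \<Rightarrow> real ^ 's" and G :: "'a \<Rightarrow> real ^ 's"
  assumes G [measurable]: "G \<in> borel_measurable M"
    and contr: "infnorm (T v - u) \<le> \<alpha> * infnorm (v - u)"
    and \<alpha>: "0 \<le> \<alpha>" and \<delta>: "0 \<le> \<delta>" and u: "infnorm u \<le> \<kappa>"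
    and inv: "AE s in M. infnorm (G s) \<le> \<kappa>"
    and close: "\<P>(s in M. infnorm (T v - G s) < \<delta>) \<ge> p"
  shows "(\<integral>\<^sup>+ s. infnorm (G s - u) \<partial>M) \<le> ennreal (\<alpha> * infnorm (v - u) + (\<delta> + 2 * \<kappa> * (1 - p)))"
proof -
  define A where "A = {s \<in> space M. infnorm (T v - G s) < \<delta>}"
  have A [measurable]: "A \<in> sets M"
    unfolding A_def by measurable
  have \<kappa>: "0 \<le> \<kappa>"
    using infnorm_pos_le[of u] u by linarith
  have e: "0 \<le> infnorm (v - u)"
    by (rule infnorm_pos_le)
  have p: "prob (space M - A) \<le> 1 - p"
    using close by (simp add: prob_compl A_def)
  have step: "AE s in M. infnorm (G s - u) \<le>
      (\<alpha> * infnorm (v - u) + \<delta>) + 2 * \<kappa> * indicator (space M - A) s"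
    using inv AE_space
  proof eventually_elim
    case (elim s)
    show ?case
    proof (cases "s \<in> A")
      case True
      have "infnorm (G s - u) \<le> infnorm (G s - T v) + infnorm (T v - u)"
        using infnorm_triangle[of "G s - T v" "T v - u"] by simp
      then show ?thesis
        using True contr by (simp add: A_def infnorm_sub[of "G s"])
    next
      case False
      then show ?thesis
        using elim infnorm_diff_le[OF elim(1) u] \<alpha> \<delta> e by (simp add: add_increasing)
    qed
  qed
  have "(\<integral>\<^sup>+ s. infnorm (G s - u) \<partial>M) \<le>
        (\<integral>\<^sup>+ s. ennreal (\<alpha> * infnorm (v - u) + \<delta>) + ennreal (2 * \<kappa>) * indicator (space M - A) s \<partial>M)"
  proof (rule nn_integral_mono_AE)
    show "AE s in M. ennreal (infnorm (G s - u)) \<le>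
        ennreal (\<alpha> * infnorm (v - u) + \<delta>) + ennreal (2 * \<kappa>) * indicator (space M - A) s"
      using step
    proof eventually_elim
      case (elim s)
      then have "ennreal (infnorm (G s - u)) \<le>
          ennreal ((\<alpha> * infnorm (v - u) + \<delta>) + 2 * \<kappa> * indicator (space M - A) s)"
        by (rule ennreal_leI)
      also have "\<dots> = ennreal (\<alpha> * infnorm (v - u) + \<delta>) + ennreal (2 * \<kappa>) * indicator (space M - A) s"
        using \<alpha> \<delta> e \<kappa> by (subst ennreal_plus) (auto simp: indicator_def)
      finally show ?case .
    qed
  qed
  also have "\<dots> = ennreal (\<alpha> * infnorm (v - u) + \<delta>) + ennreal (2 * \<kappa>) * emeasure M (space M - A)"
    by (simp add: nn_integral_add nn_integral_cmult_indicator emeasure_space_1)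
  also have "\<dots> = ennreal (\<alpha> * infnorm (v - u) + \<delta> + 2 * \<kappa> * prob (space M - A))"
    using \<alpha> \<delta> e \<kappa> by (simp add: emeasure_eq_measure ennreal_plus ennreal_mult)
  also have "\<dots> \<le> ennreal (\<alpha> * infnorm (v - u) + (\<delta> + 2 * \<kappa> * (1 - p)))"
    using p \<kappa> by (intro ennreal_leI) (simp add: mult_left_mono)
  finally show ?thesis .
qed

section \<open>The weak probabilistic fixed point\<close>

theorem theorem4p2:
  fixes T :: "real ^ 's \<Rightarrow> real ^ 's"
    and That :: "nat \<Rightarrow> (nat \<Rightarrow> real) \<Rightarrow> real ^ 's \<Rightarrow> real ^ 's"
    and vstar :: "real ^ 's"
    and \<alpha> \<kappa> :: real
  assumes alpha: "0 < \<alpha>" "\<alpha> < 1"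
    and meas: "\<And>n. n \<ge> 1 \<Longrightarrow>
          (\<lambda>(\<omega>, v). That n \<omega> v) \<in> borel_measurable (Omega \<Otimes>\<^sub>M borel)"
    and conv: "\<And>v. AE \<omega> in Omega. (\<lambda>n. infnorm (That n \<omega> v - T v)) \<longlonglongrightarrow> 0"
    and fixpt: "T vstar = vstar"
    and vstar_bound: "infnorm vstar \<le> \<kappa>"
    and iter_bound: "\<And>v0 :: nat \<Rightarrow> real ^ 's. (\<And>n. n \<ge> 1 \<Longrightarrow> infnorm (v0 n) \<le> \<kappa>) \<Longrightarrow>
          AE w in Omega_inf. \<forall>n\<ge>1. \<forall>k. infnorm (iterate \<kappa> (That n) k w (v0 n)) \<le> \<kappa>"
    and contr: "\<And>v. infnorm (T v - vstar) \<le> \<alpha> * infnorm (v - vstar)"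
    and prob_bound: "\<And>\<epsilon>. \<epsilon> > 0 \<Longrightarrow> \<exists>p :: nat \<Rightarrow> real.
          (\<forall>n\<ge>1. \<forall>v. infnorm v \<le> \<kappa> \<longrightarrow> \<P>(\<omega> in Omega. infnorm (T v - That n \<omega> v) < \<epsilon>) > p n)
          \<and> mono_on {1..} p \<and> p \<longlonglongrightarrow> 1"
  shows "(\<forall>v0 :: nat \<Rightarrow> real ^ 's. \<forall>\<epsilon>>0.
            (\<lambda>n. limsup (\<lambda>k. ereal
               (\<P>(w in Omega_inf. infnorm (iterate \<kappa> (That n) k w (v0 n) - vstar) > \<epsilon>))))
            \<longlonglongrightarrow> 0)
         \<and> weak_prob_fixed_point \<kappa> That vstar"
proof -
  interpret Omega: prob_space Omega
    by (rule prob_space_Omega)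
  interpret sequence_space Omega
    by unfold_locales
  have S: "S = Omega_inf"
    by (simp add: Omega_inf_def)
  have \<kappa>: "0 \<le> \<kappa>"
    using infnorm_pos_le[of vstar] vstar_bound by linarith
  have inv: "AE \<omega> in Omega. infnorm (That n \<omega> v) \<le> \<kappa>" if "n \<ge> 1" "infnorm v \<le> \<kappa>" for n v
  proof (rule AE_iterate_bound_imp_AE_step_bound[OF meas])
    have "AE w in Omega_inf. \<forall>n\<ge>1. \<forall>k. infnorm (iterate \<kappa> (That n) k w v) \<le> \<kappa>"
      using iter_bound[of "\<lambda>_. v"] that by simp
    then show "AE w in S. infnorm (iterate \<kappa> (That n) 1 w v) \<le> \<kappa>"
      unfolding S by eventually_elim (use that in blast)
  qed (use that in auto)
  have main: "(\<lambda>n. limsup (\<lambda>k. ereal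
      (\<P>(w in Omega_inf. infnorm (iterate \<kappa> (That n) k w (v0 n) - vstar) > \<epsilon>)))) \<longlonglongrightarrow> 0"
    (is "(\<lambda>n. limsup (\<lambda>k. ereal (?Q n k))) \<longlonglongrightarrow> 0")
    if \<epsilon>: "\<epsilon> > 0" for v0 :: "nat \<Rightarrow> real ^ 's" and \<epsilon>
  proof -
    have small: "eventually (\<lambda>n. limsup (\<lambda>k. ereal (?Q n k)) \<le> ereal \<eta>) sequentially"
      if \<eta>: "\<eta> > 0" for \<eta>
    proof -
      \<comment> \<open>The two summands of the drift constant get half of the admissible total \<open>\<eta> * ((1 - \<alpha>) * \<epsilon>)\<close> each.\<close>
      define \<delta> where "\<delta> = \<eta> * ((1 - \<alpha>) * \<epsilon>) / 2"
      have \<delta>: "\<delta> > 0"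
        using \<eta> \<epsilon> alpha by (simp add: \<delta>_def)
      obtain p :: "nat \<Rightarrow> real" where
        p: "\<And>n v. n \<ge> 1 \<Longrightarrow> infnorm v \<le> \<kappa> \<Longrightarrow> \<P>(\<omega> in Omega. infnorm (T v - That n \<omega> v) < \<delta>) > p n"
        and p_lim: "p \<longlonglongrightarrow> 1"
        using prob_bound[OF \<delta>] by blast
      have "(\<lambda>n. 2 * \<kappa> * (1 - p n)) \<longlonglongrightarrow> 2 * \<kappa> * (1 - 1)"
        by (intro tendsto_intros p_lim)
      then have "eventually (\<lambda>n. 2 * \<kappa> * (1 - p n) < \<delta>) sequentially"
        using \<delta> by (intro order_tendstoD(2)) simp_all
      with eventually_ge_at_top[of 1] show ?thesis
      proof eventually_elim
        case (elim n)
        define C where "C = \<delta> + 2 * \<kappa> * (1 - p n)"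
        have "p n \<le> 1"
          using p[OF elim(1) vstar_bound] Omega.prob_le_1 by (meson less_le_trans less_imp_le)
        then have C: "0 \<le> C"
          using \<delta> \<kappa> by (simp add: C_def)
        have drift: "(\<integral>\<^sup>+ s. infnorm (That n s v - vstar) \<partial>Omega) \<le>
            ennreal (\<alpha> * infnorm (v - vstar) + C)" if v: "infnorm v \<le> \<kappa>" for v
          unfolding C_def
        proof (rule Omega.expected_error_step)
          show "(\<lambda>s. That n s v) \<in> borel_measurable Omega"
            using measurable_compose[OF measurable_Pair2' meas[OF elim(1)], of v] by simp
          show "p n \<le> \<P>(\<omega> in Omega. infnorm (T v - That n \<omega> v) < \<delta>)"
            by (rule less_imp_le[OF p[OF elim(1) v]])
        qed (use contr alpha \<delta> vstar_bound inv[OF elim(1) v] in auto)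
        have tail: "?Q n (Suc k) \<le> (\<alpha> ^ k * (2 * \<kappa>) + C / (1 - \<alpha>)) / \<epsilon>" for k
          unfolding S[symmetric]
          by (rule deviation_probability_bound[OF meas])
            (use elim alpha C vstar_bound inv drift \<epsilon> in auto)
        have "limsup (\<lambda>k. ereal (?Q n k)) = limsup (\<lambda>k. ereal (?Q n (Suc k)))"
          by (rule limsup_shift[where u = "\<lambda>k. ereal (?Q n k)", folded Suc_eq_plus1, symmetric])
        also have "\<dots> \<le>
            limsup (\<lambda>k. ereal ((\<alpha> ^ k * (2 * \<kappa>) + C / (1 - \<alpha>)) / \<epsilon>))"
          by (intro Limsup_mono always_eventually) (simp add: tail del: iterate.simps)
        also have "\<dots> = ereal (C / (1 - \<alpha>) / \<epsilon>)"
        proof (rule lim_imp_Limsup)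
          have "(\<lambda>k. (\<alpha> ^ k * (2 * \<kappa>) + C / (1 - \<alpha>)) / \<epsilon>) \<longlonglongrightarrow> (0 * (2 * \<kappa>) + C / (1 - \<alpha>)) / \<epsilon>"
            using alpha \<epsilon> by (intro tendsto_intros LIMSEQ_power_zero) auto
          then show "(\<lambda>k. ereal ((\<alpha> ^ k * (2 * \<kappa>) + C / (1 - \<alpha>)) / \<epsilon>)) \<longlonglongrightarrow> ereal (C / (1 - \<alpha>) / \<epsilon>)"
            by simp
        qed simp
        also have "\<dots> \<le> ereal \<eta>"
          using elim alpha \<epsilon> by (simp add: C_def \<delta>_def field_simps)
        finally show ?case .
      qed
    qed
    show ?thesis
    proof (rule order_tendstoI)
      fix a :: ereal assume "a < 0"
      moreover have "0 \<le> limsup (\<lambda>k. ereal (?Q n k))" for n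
        by (intro le_Limsup always_eventually) (simp_all add: measure_nonneg)
      ultimately show "eventually (\<lambda>n. a < limsup (\<lambda>k. ereal (?Q n k))) sequentially"
        by (intro always_eventually allI) (rule less_le_trans)
    next
      fix a :: ereal assume "0 < a"
      then obtain \<eta> where "0 < ereal \<eta>" "ereal \<eta> < a"
        using ereal_dense2 by blast
      with small[of \<eta>] show "eventually (\<lambda>n. limsup (\<lambda>k. ereal (?Q n k)) < a) sequentially"
        by (auto elim!: eventually_mono)
    qed
  qed
  show ?thesis
    unfolding weak_prob_fixed_point_def by (intro conjI allI impI main)
qed

end
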